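(* Let $W$ be one of $S_n$ ($n\ge1$), $S^B_n$ ($n\ge1$), $\widetilde{S}_n$ ($n\ge3$), $\widetilde{S}^C_n$ ($n\ge2$), with window size $n$, and let $w\in W$. Then no reduced word for $w$ contains consecutive letters $i\,(i+1)\,i$ or $i\,(i-1)\,i$ for any $i\in[n-1]$ if and only if, in every reduced word for $w$, for all $i\in[n-1]$, between every two copies of the letter $i$ there is both a copy of $i-1$ and a copy of $i+1$.
   Context: - $S_n$: permutations of $[n]$. - $S^B_n$: bijections $w$ of $\{-n,\dots,n\}$ with $w(-i)=-w(i)$. - $\widetilde{S}_n$: bijections $w$ of $\mathbb{Z}$ with $w(i+n)=w(i)+n$ and $\sum_{i=1}^n w(i)=\binom{n+1}{2}$. - $\widetilde{S}^C_n$: bijections $w$ of $\mathbb{Z}$ with $w(-i)=-w(i)$ and $w(2(n+1)-i)=2(n+1)-w(i)$. Generators (each transposition extended by the group's symmetries): $s_i$ swaps $i,i+1$ for $1\le i\le n-1$; in $\widetilde{S}_n$, $s_0=s_n$ swaps $0,1$ (letters $0$ and $n$ denote the same generator); in $S^B_n$ and $\widetilde{S}^C_n$, $s_0$ swaps $-1,1$; in $\widetilde{S}^C_n$, $s_n$ swaps $n,n+2$. A letter not indexing a generator of $W$ never occurs in a word. A reduced word for $w$ is a word $i_1\cdots i_\ell$ with $w=s_{i_1}\cdots s_{i_\ell}$ and $\ell$ minimal. *)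

theory Defs
  imports "HOL-Combinatorics.Permutations" "HOL-Library.Sublist"
begin

datatype family = Sym | SignedSym | AffSym | AffSignedSym

fun min_size :: "family \<Rightarrow> nat" where
  "min_size Sym = 1"
| "min_size SignedSym = 1"
| "min_size AffSym = 3"
| "min_size AffSignedSym = 2"

(* Elements of all four groups are functions on the integers; the permutations of a finite
   set of integers are extended by the identity, as in permutes. *)
fun group_elems :: "family \<Rightarrow> nat \<Rightarrow> (int \<Rightarrow> int) set" where
  "group_elems Sym n = {w. w permutes {1..int n}}"
| "group_elems SignedSym n =
     {w. w permutes {- int n..int n} \<and> (\<forall>i\<in>{- int n..int n}. w (- i) = - w i)}"
| "group_elems AffSym n =
     {w. bij w \<and> (\<forall>i. w (i + int n) = w i + int n) \<and>
         (\<Sum>i=1..int n. w i) = int ((n + 1) choose 2)}"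
| "group_elems AffSignedSym n =
     {w. bij w \<and> (\<forall>i. w (- i) = - w i) \<and>
         (\<forall>i. w (2 * (int n + 1) - i) = 2 * (int n + 1) - w i)}"

(* Swaps a + k * m and b + k * m for every integer k (if a and b are incongruent modulo m). *)
definition periodic_swap :: "int \<Rightarrow> int \<Rightarrow> int \<Rightarrow> int \<Rightarrow> int" where
  "periodic_swap m a b x =
     (if x mod m = a mod m then x + (b - a)
      else if x mod m = b mod m then x + (a - b)
      else x)"

fun letters :: "family \<Rightarrow> nat \<Rightarrow> nat set" where
  "letters Sym n = {1..<n}"
| "letters SignedSym n = {0..<n}"
| "letters AffSym n = {0..<n}"
| "letters AffSignedSym n = {0..n}"

(* In the affine symmetric group the letters 0 and n are the same; it is written 0 in words. *)
fun letter :: "family \<Rightarrow> nat \<Rightarrow> nat \<Rightarrow> nat" where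
  "letter AffSym n k = k mod n"
| "letter _ n k = k"

(* The symmetries w (- i) = - w i and w (2 * (n + 1) - i) = 2 * (n + 1) - w i together force
   w (i + 2 * (n + 1)) = w i + 2 * (n + 1), hence the period in the last clause.
   Values outside letters W n are irrelevant. *)
fun gen :: "family \<Rightarrow> nat \<Rightarrow> nat \<Rightarrow> int \<Rightarrow> int" where
  "gen Sym n i = transpose (int i) (int i + 1)"
| "gen SignedSym n i =
     (if i = 0 then transpose (- 1) 1
      else transpose (int i) (int i + 1) \<circ> transpose (- int i) (- (int i + 1)))"
| "gen AffSym n i = periodic_swap (int n) (int i) (int i + 1)"
| "gen AffSignedSym n i =
     (let m = 2 * (int n + 1) in
      if i = 0 then periodic_swap m (- 1) 1
      else if i = n then periodic_swap m (int n) (int n + 2)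
      else periodic_swap m (int i) (int i + 1) \<circ>
           periodic_swap m (- int i) (- (int i + 1)))"

definition word_prod :: "family \<Rightarrow> nat \<Rightarrow> nat list \<Rightarrow> int \<Rightarrow> int" where
  "word_prod W n u = foldr (\<lambda>i f. gen W n i \<circ> f) u id"

definition word_for :: "family \<Rightarrow> nat \<Rightarrow> (int \<Rightarrow> int) \<Rightarrow> nat list \<Rightarrow> bool" where
  "word_for W n w u \<longleftrightarrow> set u \<subseteq> letters W n \<and> word_prod W n u = w"

definition reduced_word :: "family \<Rightarrow> nat \<Rightarrow> (int \<Rightarrow> int) \<Rightarrow> nat list \<Rightarrow> bool" where
  "reduced_word W n w u \<longleftrightarrow>
     word_for W n w u \<and> (\<forall>v. word_for W n w v \<longrightarrow> length u \<le> length v)"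

definition occurs_between :: "nat \<Rightarrow> nat list \<Rightarrow> nat \<Rightarrow> nat \<Rightarrow> bool" where
  "occurs_between k u p q \<longleftrightarrow> (\<exists>r. p < r \<and> r < q \<and> u ! r = k)"

end

theory Submission
  imports Defs
begin

text \<open>
  Only the involution, commutation and (in the affine symmetric group) braid relations are
  needed. Among the factors \<open>i b i\<close> of reduced words in which \<open>b\<close> misses one of the two
  neighbours of \<open>i\<close>, take a shortest one. Then \<open>b\<close> does not contain \<open>i\<close>, and only the other
  neighbour \<open>j\<close> can obstruct moving \<open>i\<close> through \<open>b\<close>. If \<open>j\<close> does not occur in \<open>b\<close>, the two
  copies of \<open>i\<close> cancel; if it occurs once, commutations produce the forbidden \<open>i j i\<close>; if it
  occurs twice, two successive copies of \<open>j\<close> enclose a shorter word without \<open>i\<close>, which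
  contradicts minimality, or reducedness when \<open>j\<close> is an end node of the diagram.
\<close>

section \<open>Products of words and replacement of factors in reduced words\<close>

lemma word_prod_simps [simp]:
  "word_prod W n [] = id"
  "word_prod W n (i # u) = gen W n i \<circ> word_prod W n u"
  by (simp_all add: word_prod_def)

lemma word_prod_append [simp]: "word_prod W n (u @ v) = word_prod W n u \<circ> word_prod W n v"
  by (induction u) (simp_all add: comp_assoc)

lemma gen_word_prod_commute:
  assumes "\<And>l. l \<in> set b \<Longrightarrow> gen W n i \<circ> gen W n l = gen W n l \<circ> gen W n i"
  shows "gen W n i \<circ> word_prod W n b = word_prod W n b \<circ> gen W n i"
  using assms
proof (induction b)
  case (Cons l b)
  have "gen W n i \<circ> gen W n l = gen W n l \<circ> gen W n i"
    using Cons.prems by (meson list.set_intros(1))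
  moreover have "gen W n i \<circ> word_prod W n b = word_prod W n b \<circ> gen W n i"
    using Cons.IH Cons.prems by (meson list.set_intros(2))
  ultimately show ?case
    by (simp add: fun_eq_iff)
qed simp

lemma reduced_word_subst:
  assumes "reduced_word W n w (a @ b @ c)"
    and "word_prod W n b' = word_prod W n b" "set b' \<subseteq> letters W n" "length b' = length b"
  shows "reduced_word W n w (a @ b' @ c)"
  using assms by (auto simp: reduced_word_def word_for_def)

lemma reduced_word_factor_length:
  assumes "reduced_word W n w (a @ b @ c)"
    and "word_prod W n b' = word_prod W n b" "set b' \<subseteq> letters W n"
  shows "length b \<le> length b'"
proof -
  have "word_for W n w (a @ b' @ c)"
    using assms by (auto simp: reduced_word_def word_for_def)
  then have "length (a @ b @ c) \<le> length (a @ b' @ c)"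
    using assms(1) unfolding reduced_word_def by blast
  then show ?thesis by simp
qed

text \<open>Moving the first \<open>i\<close> through \<open>b\<close> makes the two copies meet and
  cancel, so \<open>b\<close> alone has the product of the whole factor with two letters
  fewer.\<close>

lemma reduced_word_not_cancel:
  assumes "reduced_word W n w (a @ (i # b @ [i]) @ c)"
    and "gen W n i \<circ> gen W n i = id"
    and "\<And>l. l \<in> set b \<Longrightarrow> gen W n i \<circ> gen W n l = gen W n l \<circ> gen W n i"
  shows False
proof -
  have "word_prod W n b = word_prod W n (i # b @ [i])"
    using gen_word_prod_commute[OF assms(3)] assms(2) by (simp add: fun_eq_iff)
  moreover have "set b \<subseteq> letters W n"
    using assms(1) by (auto simp: reduced_word_def word_for_def)
  ultimately have "length (i # b @ [i]) \<le> length b"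
    by (rule reduced_word_factor_length[OF assms(1)])
  then show False by simp
qed

section \<open>The minimality argument on factors \<open>i b i\<close>\<close>

text \<open>
  The set \<open>M\<close> collects the letters with designated neighbours \<open>x\<close> and \<open>y\<close>; a designated
  neighbour need not index a generator.
\<close>

lemma neighbours_between:
  assumes inv: "\<And>i. i \<in> letters W n \<Longrightarrow> gen W n i \<circ> gen W n i = id"
    and comm: "\<And>i l. i \<in> M \<Longrightarrow> l \<in> letters W n \<Longrightarrow> l \<noteq> x i \<Longrightarrow> l \<noteq> y i \<Longrightarrow>
                 gen W n i \<circ> gen W n l = gen W n l \<circ> gen W n i"
    and sym: "\<And>i j. i \<in> M \<Longrightarrow> j \<in> M \<Longrightarrow> j \<in> {x i, y i} \<Longrightarrow> i \<in> {x j, y j}"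
    and leaf: "\<And>i j l. i \<in> M \<Longrightarrow> j \<in> letters W n - M \<Longrightarrow> j \<in> {x i, y i} \<Longrightarrow>
                 l \<in> letters W n \<Longrightarrow> l \<noteq> i \<Longrightarrow>
                 gen W n j \<circ> gen W n l = gen W n l \<circ> gen W n j"
    and avoid: "\<And>u i j. reduced_word W n w u \<Longrightarrow> i \<in> M \<Longrightarrow> j \<in> {x i, y i} \<Longrightarrow>
                 \<not> sublist [i, j, i] u"
    and "reduced_word W n w (a @ (i # b @ [i]) @ c)" and "i \<in> M"
  shows "{x i, y i} \<subseteq> set b"
  using assms(6,7)
proof (induction "length b" arbitrary: a i b c rule: less_induct)
  case less
  note red = less.prems(1)
  have L: "set (i # b) \<subseteq> letters W n"
    using red by (auto simp: reduced_word_def word_for_def)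
  show ?case
  proof (rule ccontr)
    assume "\<not> {x i, y i} \<subseteq> set b"
    \<comment> \<open>\<open>k\<close> is a missing neighbour, which leaves \<open>j\<close> as the
      only letter of \<open>b\<close> that may fail to commute with \<open>i\<close>.\<close>
    then obtain j k where k: "k \<notin> set b" and jk: "{x i, y i} = {j, k}"
      by auto
    have commb: "gen W n i \<circ> gen W n l = gen W n l \<circ> gen W n i" if "l \<in> set b" "l \<noteq> j" for l
      using comm[OF less.prems(2), of l] that k jk L by (auto simp: doubleton_eq_iff)
    \<comment> \<open>A further \<open>i\<close> would cut off a shorter factor
      \<open>i b1 i\<close>, whose interior already contains both neighbours, \<open>k\<close>
      included.\<close>
    have "i \<notin> set b"
    proof
      assume "i \<in> set b"
      then obtain b1 b2 where b: "b = b1 @ i # b2"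
        by (auto dest: split_list)
      have "{x i, y i} \<subseteq> set b1"
        using less.hyps[of b1 a i "b2 @ i # c"] less.prems b by simp
      then show False
        using jk k b by auto
    qed
    have "j \<in> set b"
      using reduced_word_not_cancel[OF red inv] commb L by force
    then obtain b1 b2 where b: "b = b1 @ j # b2" and j1: "j \<notin> set b1"
      by (auto dest: split_list_first)
    have "j \<in> set b2"
    proof (rule ccontr)
      assume j2: "j \<notin> set b2"
      \<comment> \<open>Both halves commute with \<open>i\<close>, so \<open>i b1 j b2 i\<close> can
        be rearranged to \<open>b1 i j i b2\<close>.\<close>
      have "gen W n i \<circ> word_prod W n b1 = word_prod W n b1 \<circ> gen W n i"
        "gen W n i \<circ> word_prod W n b2 = word_prod W n b2 \<circ> gen W n i"
        using b j1 j2 by (auto intro!: gen_word_prod_commute commb simp del: o_apply)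
      then have "word_prod W n (b1 @ [i, j, i] @ b2) = word_prod W n (i # b @ [i])"
        by (simp add: fun_eq_iff b)
      then have "reduced_word W n w (a @ (b1 @ [i, j, i] @ b2) @ c)"
        using L b by (intro reduced_word_subst[OF red]) auto
      moreover have "sublist [i, j, i] (a @ (b1 @ [i, j, i] @ b2) @ c)"
        unfolding sublist_def by (metis append.assoc)
      ultimately show False
        using avoid less.prems(2) jk by blast
    qed
    then obtain b3 b4 where b2: "b2 = b3 @ j # b4"
      by (auto dest: split_list)
    \<comment> \<open>\<open>b3\<close> may itself contain \<open>j\<close>. The induction
      hypothesis allows this, and so does the cancellation, since \<open>j\<close> commutes with
      itself.\<close>
    have red': "reduced_word W n w ((a @ i # b1) @ (j # b3 @ [j]) @ (b4 @ i # c))"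
      using red b b2 by simp
    show False
    proof (cases "j \<in> M")
      case True
      \<comment> \<open>By \<open>sym\<close>, \<open>i\<close> is a designated neighbour of
        \<open>j\<close>, so the induction hypothesis forces \<open>i\<close> into
        \<open>b3\<close>.\<close>
      then have "{x j, y j} \<subseteq> set b3"
        using less.hyps[OF _ red'] b b2 by simp
      then show False
        using sym[of i j] True less.prems(2) jk \<open>i \<notin> set b\<close> b b2 by auto
    next
      case False
      have jL: "j \<in> letters W n"
        using L b by auto
      \<comment> \<open>A letter \<open>j\<close> outside \<open>M\<close> can fail to commute only
        with \<open>i\<close>, which is absent from \<open>b3\<close>; hence the two copies of
        \<open>j\<close> cancel.\<close>
      have "gen W n j \<circ> gen W n l = gen W n l \<circ> gen W n j" if "l \<in> set b3" for l
        using that leaf[OF less.prems(2), of j l] False jL jk L \<open>i \<notin> set b\<close> b b2 by auto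
      then show False
        using reduced_word_not_cancel[OF red' inv[OF jL]] by blast
    qed
  qed
qed

section \<open>Relations between transpositions and between periodic swaps\<close>

lemma transpose_commute_disjoint:
  assumes "a \<noteq> c" "a \<noteq> d" "b \<noteq> c" "b \<noteq> d"
  shows "transpose a b \<circ> transpose c d = transpose c d \<circ> transpose a b"
  using assms by (auto simp: fun_eq_iff transpose_def)

text \<open>A nonzero integer of absolute value below \<open>m\<close> is not a multiple of
  \<open>m\<close>. This turns the incongruences required of periodic swaps into linear
  inequalities.\<close>

lemma mod_neq_if_close:
  fixes a b m :: int
  assumes "a \<noteq> b" "\<bar>a - b\<bar> < m"
  shows "a mod m \<noteq> b mod m"
proof
  assume "a mod m = b mod m"
  then have "m dvd a - b"
    by (simp add: mod_eq_dvd_iff)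
  then show False
    using assms zdvd_imp_le[of m "\<bar>a - b\<bar>"] by auto
qed

text \<open>The residue of the value determines which branch a further periodic swap takes when
  applied to it.\<close>

lemma periodic_swap_mod:
  "periodic_swap m a b x mod m =
     (if x mod m = a mod m then b mod m else if x mod m = b mod m then a mod m else x mod m)"
proof -
  have "(x + (d - c)) mod m = d mod m" if "x mod m = c mod m" for c d
    using that by (metis add_diff_cancel_left' add_diff_eq diff_add_cancel mod_add_left_eq)
  then show ?thesis
    by (simp add: periodic_swap_def)
qed

lemma periodic_swap_involution:
  assumes "a mod m \<noteq> b mod m"
  shows "periodic_swap m a b \<circ> periodic_swap m a b = id"
proof
  fix x
  \<comment> \<open>The outer swap is unfolded first, because its case distinction depends only on
    the residue of the inner value.\<close>
  show "(periodic_swap m a b \<circ> periodic_swap m a b) x = id x"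
    using assms periodic_swap_mod[of m a b x]
    by (auto simp: periodic_swap_def[of m a b "periodic_swap m a b x"])
      (auto simp: periodic_swap_def)
qed

lemma periodic_swap_commute:
  assumes "a mod m \<noteq> c mod m" "a mod m \<noteq> d mod m" "b mod m \<noteq> c mod m" "b mod m \<noteq> d mod m"
  shows "periodic_swap m a b \<circ> periodic_swap m c d = periodic_swap m c d \<circ> periodic_swap m a b"
proof
  fix x
  show "(periodic_swap m a b \<circ> periodic_swap m c d) x =
        (periodic_swap m c d \<circ> periodic_swap m a b) x"
    using assms periodic_swap_mod[of m a b x] periodic_swap_mod[of m c d x]
    by (auto simp: periodic_swap_def[of m a b "periodic_swap m c d x"]
        periodic_swap_def[of m c d "periodic_swap m a b x"])
      (auto simp: periodic_swap_def)
qed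

lemma periodic_swap_involution_if_close:
  assumes "a \<noteq> b" "\<bar>a - b\<bar> < m"
  shows "periodic_swap m a b \<circ> periodic_swap m a b = id"
  using assms by (intro periodic_swap_involution mod_neq_if_close)

lemma periodic_swap_commute_if_close:
  assumes "a \<noteq> c" "a \<noteq> d" "b \<noteq> c" "b \<noteq> d"
    and "\<bar>a - c\<bar> < m" "\<bar>a - d\<bar> < m" "\<bar>b - c\<bar> < m" "\<bar>b - d\<bar> < m"
  shows "periodic_swap m a b \<circ> periodic_swap m c d = periodic_swap m c d \<circ> periodic_swap m a b"
  using assms by (intro periodic_swap_commute mod_neq_if_close)

lemma periodic_swap_braid:
  assumes "a mod m \<noteq> b mod m" "b mod m \<noteq> c mod m" "a mod m \<noteq> c mod m"
  shows "periodic_swap m a b \<circ> periodic_swap m b c \<circ> periodic_swap m a b =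
         periodic_swap m b c \<circ> periodic_swap m a b \<circ> periodic_swap m b c"
proof
  fix x
  let ?s = "periodic_swap m a b" and ?t = "periodic_swap m b c"
  have s: "?s y = (if y mod m = a mod m then y + (b - a)
      else if y mod m = b mod m then y + (a - b) else y)" for y
    by (simp add: periodic_swap_def)
  have t: "?t y = (if y mod m = b mod m then y + (c - b)
      else if y mod m = c mod m then y + (b - c) else y)" for y
    by (simp add: periodic_swap_def)
  show "(?s \<circ> ?t \<circ> ?s) x = (?t \<circ> ?s \<circ> ?t) x"
    \<comment> \<open>Unfolding from the outside inwards reduces every case distinction to the
      residue of \<open>x\<close>.\<close>
    unfolding o_apply s[of "?t (?s x)"] t[of "?s (?t x)"] periodic_swap_mod
    unfolding s[of "?t x"] t[of "?s x"] periodic_swap_mod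
    unfolding s[of x] t[of x]
    using assms by auto
qed

text \<open>Only the residues and the difference of the two points enter. The affine generator for 0
  can thus be written as the swap of \<open>n\<close> and \<open>n + 1\<close>.\<close>

lemma periodic_swap_shift: "periodic_swap m (a + m) (b + m) = periodic_swap m a b"
  by (simp add: periodic_swap_def fun_eq_iff)

section \<open>Relations between the generators of the four groups\<close>

lemma gen_involution:
  assumes "min_size W \<le> n" "i \<in> letters W n"
  shows "gen W n i \<circ> gen W n i = id"
proof -
  \<comment> \<open>Away from the end nodes, a signed generator is a product of two commuting
    involutions.\<close>
  have *: "(f \<circ> g) \<circ> (f \<circ> g) = id"
    if "f \<circ> f = id" "g \<circ> g = id" "f \<circ> g = g \<circ> f" for f g :: "int \<Rightarrow> int"
    using that by (metis comp_assoc comp_id)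
  show ?thesis
  proof (cases W)
    case Sym
    then show ?thesis by simp
  next
    case SignedSym
    then show ?thesis
      by (auto intro!: * transpose_commute_disjoint)
  next
    case AffSym
    then show ?thesis
      using assms by (auto intro!: periodic_swap_involution_if_close)
  next
    case AffSignedSym
    then show ?thesis
      using assms
      by (auto simp: Let_def intro!: * periodic_swap_involution_if_close
          periodic_swap_commute_if_close)
  qed
qed

lemma gen_commute_aux:
  assumes "W \<noteq> AffSym" "min_size W \<le> n" "i \<in> letters W n" "j \<in> letters W n" "i + 1 < j"
  shows "gen W n i \<circ> gen W n j = gen W n j \<circ> gen W n i"
proof -
  have *: "f \<circ> (g \<circ> h) = (g \<circ> h) \<circ> f"
    if "f \<circ> g = g \<circ> f" "f \<circ> h = h \<circ> f" for f g h :: "int \<Rightarrow> int"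
    using that by (metis comp_assoc)
  have **: "(g \<circ> h) \<circ> f = f \<circ> (g \<circ> h)"
    if "g \<circ> f = f \<circ> g" "h \<circ> f = f \<circ> h" for f g h :: "int \<Rightarrow> int"
    using that by (metis comp_assoc)
  show ?thesis
  proof (cases W)
    case Sym
    then show ?thesis
      using assms by (auto intro!: transpose_commute_disjoint)
  next
    case SignedSym
    show ?thesis
      using assms unfolding SignedSym gen.simps if_distrib
      by (auto simp del: o_apply intro!: * ** transpose_commute_disjoint)
  next
    case AffSym
    then show ?thesis using assms by simp
  next
    case AffSignedSym
    \<comment> \<open>The extreme case is \<open>j = n\<close>, \<open>i = n - 2\<close>: the points
      \<open>n + 2\<close> and \<open>-(n - 1)\<close> are \<open>2 * n + 1\<close> apart, one less
      than the period.\<close>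
    show ?thesis
      using assms unfolding AffSignedSym gen.simps Let_def
      by (auto intro!: * ** periodic_swap_commute_if_close)
  qed
qed

lemma gen_commute:
  assumes "W \<noteq> AffSym" "min_size W \<le> n" "i \<in> letters W n" "j \<in> letters W n"
    and "j \<noteq> i + 1" "i \<noteq> j + 1"
  shows "gen W n i \<circ> gen W n j = gen W n j \<circ> gen W n i"
proof -
  consider "i + 1 < j" | "j + 1 < i" | "i = j"
    using assms(5,6) by linarith
  then show ?thesis
    using gen_commute_aux[of W n i j] gen_commute_aux[of W n j i] assms(1-4) by cases simp_all
qed

text \<open>The last hypothesis excludes the pair 0, \<open>n - 1\<close>, whose swaps share the
  residue 0. For all other pairs the points involved are distinct and less than \<open>n\<close>
  apart.\<close>

lemma gen_AffSym_commute_aux: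
  assumes "3 \<le> n" "j < n" "i + 1 < j" "i = 0 \<longrightarrow> j + 1 \<noteq> n"
  shows "gen AffSym n i \<circ> gen AffSym n j = gen AffSym n j \<circ> gen AffSym n i"
  using assms by (auto intro!: periodic_swap_commute_if_close)

lemma gen_AffSym_commute:
  assumes "3 \<le> n" "i < n" "j < n" "j \<noteq> (i + n - 1) mod n" "j \<noteq> (i + 1) mod n"
  shows "gen AffSym n i \<circ> gen AffSym n j = gen AffSym n j \<circ> gen AffSym n i"
proof -
  have *: "j \<noteq> i + 1" "i = 0 \<longrightarrow> j + 1 \<noteq> n" "j = 0 \<longrightarrow> i + 1 \<noteq> n"
    using assms by auto
  have **: "i \<noteq> j + 1"
    using assms by auto
  consider "i + 1 < j" | "j + 1 < i" | "i = j"
    using * ** by linarith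
  then show ?thesis
    using gen_AffSym_commute_aux[of n j i] gen_AffSym_commute_aux[of n i j] * assms(1-3)
    by cases simp_all
qed

text \<open>The letter 0 lies outside \<open>{1..n - 1}\<close>, so factors \<open>0 j 0\<close> are
  not forbidden directly. These relations turn them into \<open>j 0 j\<close>, which is
  forbidden.\<close>

lemma gen_AffSym_braid:
  assumes "3 \<le> n"
  shows "gen AffSym n 0 \<circ> gen AffSym n 1 \<circ> gen AffSym n 0 =
         gen AffSym n 1 \<circ> gen AffSym n 0 \<circ> gen AffSym n 1"
    and "gen AffSym n 0 \<circ> gen AffSym n (n - 1) \<circ> gen AffSym n 0 =
         gen AffSym n (n - 1) \<circ> gen AffSym n 0 \<circ> gen AffSym n (n - 1)"
proof -
  show "gen AffSym n 0 \<circ> gen AffSym n 1 \<circ> gen AffSym n 0 =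
        gen AffSym n 1 \<circ> gen AffSym n 0 \<circ> gen AffSym n 1"
    using assms periodic_swap_braid[of 0 "int n" 1 2] by (simp add: mod_neq_if_close)
  \<comment> \<open>Shifted by one period, the generator for 0 literally shares the point
    \<open>n\<close> with the generator for \<open>n - 1\<close>.\<close>
  have "gen AffSym n 0 = periodic_swap (int n) (int n) (int n + 1)"
    using periodic_swap_shift[of "int n" 0 1] by (simp add: add.commute)
  moreover have "gen AffSym n (n - 1) = periodic_swap (int n) (int n - 1) (int n)"
    using assms by (simp add: of_nat_diff)
  ultimately show "gen AffSym n 0 \<circ> gen AffSym n (n - 1) \<circ> gen AffSym n 0 =
        gen AffSym n (n - 1) \<circ> gen AffSym n 0 \<circ> gen AffSym n (n - 1)"
    using assms periodic_swap_braid[of "int n - 1" "int n" "int n" "int n + 1"]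
      mod_neq_if_close[of "int n - 1" "int n" "int n"]
      mod_neq_if_close[of "int n" "int n + 1" "int n"]
      mod_neq_if_close[of "int n - 1" "int n + 1" "int n"]
    by simp
qed

section \<open>Application to the path-shaped diagrams and to the affine cycle\<close>

lemma reduced_word_braid_subst:
  assumes "reduced_word W n w u" "sublist [i, j, i] u"
    and "gen W n i \<circ> gen W n j \<circ> gen W n i = gen W n j \<circ> gen W n i \<circ> gen W n j"
  obtains v where "reduced_word W n w v" "sublist [j, i, j] v"
proof -
  obtain a c where u: "u = a @ [i, j, i] @ c"
    using assms(2) by (auto simp: sublist_def)
  have "set [j, i, j] \<subseteq> letters W n"
    using assms(1) by (simp add: u reduced_word_def word_for_def)
  then have "reduced_word W n w (a @ [j, i, j] @ c)"
    using assms(1,3) unfolding u by (elim reduced_word_subst) (simp_all add: comp_assoc)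
  then show thesis
    using that by blast
qed

text \<open>\<open>neighbours_between\<close> is applied with \<open>M = {1..n - 1}\<close> on a
  path whose possible further nodes are the ends 0 and \<open>n\<close>, and for
  \<open>AffSym\<close> with \<open>M\<close> the set of all letters on a cycle.\<close>

lemma neighbours_between_of_avoid:
  assumes size: "min_size W \<le> n"
    and avoid: "\<And>u i. reduced_word W n w u \<Longrightarrow> i \<in> {1..n - 1} \<Longrightarrow>
       \<not> sublist [i, letter W n (i + 1), i] u \<and> \<not> sublist [i, letter W n (i - 1), i] u"
    and red: "reduced_word W n w (a @ (i # b @ [i]) @ c)" and i: "i \<in> {1..n - 1}"
  shows "{letter W n (i - 1), letter W n (i + 1)} \<subseteq> set b"
proof (cases "W = AffSym")
  case False
  then have lt: "letter W n = (\<lambda>k. k)"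
    by (cases W) auto
  have ends: "j = 0 \<or> j = n" if "j \<in> letters W n - {1..n - 1}" for j
    using that by (cases W) auto
  have Ls: "{1..n - 1} \<subseteq> letters W n"
    by (cases W) auto
  have le: "l \<le> n" if "l \<in> letters W n" for l
    using that by (cases W) auto
  have "{i - 1, i + 1} \<subseteq> set b"
  proof (rule neighbours_between[where x = "\<lambda>i. i - 1" and y = "\<lambda>i. i + 1", OF _ _ _ _ _ red i])
    show "gen W n i \<circ> gen W n i = id" if "i \<in> letters W n" for i
      using gen_involution size that .
    show "gen W n i \<circ> gen W n l = gen W n l \<circ> gen W n i"
      if "i \<in> {1..n - 1}" "l \<in> letters W n" "l \<noteq> i - 1" "l \<noteq> i + 1" for i l
      using that Ls by (intro gen_commute False size) auto
    show "i \<in> {j - 1, j + 1}" if "i \<in> {1..n - 1}" "j \<in> {1..n - 1}" "j \<in> {i - 1, i + 1}" for i j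
      using that by auto
    \<comment> \<open>Here \<open>j\<close> is 0 or \<open>n\<close>, and \<open>i\<close> is its
      only neighbour in the diagram, since \<open>n + 1\<close> is not a letter.\<close>
    show "gen W n j \<circ> gen W n l = gen W n l \<circ> gen W n j"
      if "i \<in> {1..n - 1}" "j \<in> letters W n - {1..n - 1}" "j \<in> {i - 1, i + 1}"
        "l \<in> letters W n" "l \<noteq> i" for i j l
      using that ends[of j] le[of l] by (intro gen_commute False size) auto
    show "\<not> sublist [i, j, i] u"
      if "reduced_word W n w u" "i \<in> {1..n - 1}" "j \<in> {i - 1, i + 1}" for u i j
      using avoid[OF that(1,2)] that(3) lt by auto
  qed
  then show ?thesis
    using lt by simp
next
  case W: True
  then have n: "3 \<le> n"
    using size by simp
  have step: "(i + n - 1) mod n = (if i = 0 then n - 1 else i - 1)"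
    "(i + 1) mod n = (if i + 1 = n then 0 else i + 1)" if "i < n" for i
  proof -
    show "(i + n - 1) mod n = (if i = 0 then n - 1 else i - 1)"
      using that n by (cases i) auto
    show "(i + 1) mod n = (if i + 1 = n then 0 else i + 1)"
      using that by auto
  qed
  \<comment> \<open>Adding \<open>n\<close> before subtracting keeps natural subtraction from
    sending the left neighbour of 0 to 0.\<close>
  have "{(i + n - 1) mod n, (i + 1) mod n} \<subseteq> set b"
  proof (rule neighbours_between[where x = "\<lambda>i. (i + n - 1) mod n" and y = "\<lambda>i. (i + 1) mod n"
        and M = "letters W n", OF _ _ _ _ _ red])
    show "gen W n i \<circ> gen W n i = id" if "i \<in> letters W n" for i
      using gen_involution size that .
    show "gen W n i \<circ> gen W n l = gen W n l \<circ> gen W n i"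
      if "i \<in> letters W n" "l \<in> letters W n" "l \<noteq> (i + n - 1) mod n" "l \<noteq> (i + 1) mod n" for i l
      using that n gen_AffSym_commute[of n i l] W by simp
    show "i \<in> {(j + n - 1) mod n, (j + 1) mod n}"
      if "i \<in> letters W n" "j \<in> letters W n" "j \<in> {(i + n - 1) mod n, (i + 1) mod n}" for i j
      using that n W step[of i] step[of j] by (auto split: if_splits)
    show "\<not> sublist [i, j, i] u"
      if u: "reduced_word W n w u" and "i \<in> letters W n"
        and j: "j \<in> {(i + n - 1) mod n, (i + 1) mod n}" for u i j
    proof (cases "i = 0")
      case False
      then have i: "i \<in> {1..n - 1}"
        using that W by auto
      then have "letter W n (i - 1) = i - 1"
        using W by auto
      then show ?thesis
        using avoid[OF u i] j W n step[of i] i by auto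
    next
      case i0: True
      have j': "j = 1 \<or> j = n - 1"
        using j n i0 by auto
      have "1 \<in> {1..n - 1}" "n - 1 \<in> {1..n - 1}" "letter W n (1 - 1) = 0"
        "letter W n (n - 1 + 1) = 0"
        using n W by auto
      \<comment> \<open>For \<open>j = 1\<close> the letter 0 is the left neighbour; for
        \<open>j = n - 1\<close> it is the right one, \<open>n\<close> being written as 0.\<close>
      then have "\<not> sublist [j, 0, j] v" if "reduced_word W n w v" for v
        using j' avoid[OF that, of 1] avoid[OF that, of "n - 1"] by metis
      then show ?thesis
        using reduced_word_braid_subst[OF u, of 0 j] gen_AffSym_braid[OF n] j' W i0 by metis
    qed
    show "i \<in> letters W n"
      using i W by auto
  \<comment> \<open>The remaining condition, on letters outside \<open>M\<close>, is vacuous because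
    \<open>M\<close> contains every letter.\<close>
  qed simp
  then show ?thesis
    using i W n step[of i] by (auto split: if_splits)
qed

section \<open>From positions in a word to factors, and the equivalence\<close>

lemma split_at_two:
  assumes "p < q" "q < length u" "u ! p = i" "u ! q = i"
  obtains a b c where "u = a @ (i # b @ [i]) @ c"
    and "\<And>k. k \<in> set b \<Longrightarrow> occurs_between k u p q"
proof
  let ?b = "drop (Suc p) (take q u)"
  have "u = take q u @ u ! q # drop (Suc q) u"
    using assms by (metis id_take_nth_drop)
  moreover have "take q u = take p u @ u ! p # ?b"
    using assms id_take_nth_drop[of p "take q u"] by (simp add: min_def)
  ultimately show "u = take p u @ (i # ?b @ [i]) @ drop (Suc q) u"
    using assms by (metis append.assoc append_Cons append_Nil)
  fix k
  assume "k \<in> set ?b"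
  then obtain r where "r < q - Suc p" "u ! (Suc p + r) = k"
    using assms by (auto simp: in_set_conv_nth min_def)
  then show "occurs_between k u p q"
    unfolding occurs_between_def by (intro exI[of _ "Suc p + r"]) auto
qed

theorem theorem3p5:
  fixes W :: family and n :: nat and w :: "int \<Rightarrow> int"
  assumes "min_size W \<le> n" and "w \<in> group_elems W n"
  shows "(\<forall>u. reduced_word W n w u \<longrightarrow>
            (\<forall>i\<in>{1..n - 1}. \<not> sublist [i, letter W n (i + 1), i] u \<and>
                             \<not> sublist [i, letter W n (i - 1), i] u))
     \<longleftrightarrow>
         (\<forall>u. reduced_word W n w u \<longrightarrow>
            (\<forall>i\<in>{1..n - 1}. \<forall>p q. p < q \<and> q < length u \<and> u ! p = i \<and> u ! q = i \<longrightarrow>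
               occurs_between (letter W n (i - 1)) u p q \<and>
               occurs_between (letter W n (i + 1)) u p q))"
proof (intro iffI allI impI ballI)
  fix u i p q
  assume "\<forall>u. reduced_word W n w u \<longrightarrow>
            (\<forall>i\<in>{1..n - 1}. \<not> sublist [i, letter W n (i + 1), i] u \<and>
                             \<not> sublist [i, letter W n (i - 1), i] u)"
    and u: "reduced_word W n w u" and i: "i \<in> {1..n - 1}"
    and pq: "p < q \<and> q < length u \<and> u ! p = i \<and> u ! q = i"
  then have avoid: "\<not> sublist [i, letter W n (i + 1), i] u \<and>
      \<not> sublist [i, letter W n (i - 1), i] u" if "reduced_word W n w u" "i \<in> {1..n - 1}" for u i
    using that by blast
  obtain a b c where abc: "u = a @ (i # b @ [i]) @ c"
    and b: "\<And>k. k \<in> set b \<Longrightarrow> occurs_between k u p q"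
    using pq split_at_two by metis
  have "{letter W n (i - 1), letter W n (i + 1)} \<subseteq> set b"
    using neighbours_between_of_avoid[OF assms(1) avoid _ i] u abc by blast
  then show "occurs_between (letter W n (i - 1)) u p q \<and>
        occurs_between (letter W n (i + 1)) u p q"
    using b by simp
next
  fix u i
  assume between: "\<forall>u. reduced_word W n w u \<longrightarrow>
            (\<forall>i\<in>{1..n - 1}. \<forall>p q. p < q \<and> q < length u \<and> u ! p = i \<and> u ! q = i \<longrightarrow>
               occurs_between (letter W n (i - 1)) u p q \<and>
               occurs_between (letter W n (i + 1)) u p q)"
    and u: "reduced_word W n w u" and i: "i \<in> {1..n - 1}"
  \<comment> \<open>For \<open>AffSym\<close> this rests on \<open>3 \<le> n\<close>: the two
    indices differ by 2, which is not a multiple of \<open>n\<close>.\<close>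
  have neq: "letter W n (i - 1) \<noteq> letter W n (i + 1)"
    using assms(1) i by (cases W; cases "i + 1 = n") auto
  have "\<not> sublist [i, j, i] u" for j
  proof
    assume "sublist [i, j, i] u"
    then obtain a c where u_eq: "u = a @ [i, j, i] @ c"
      by (auto simp: sublist_def)
    let ?p = "length a"
    \<comment> \<open>A single position lies strictly between the two copies of \<open>i\<close>, so
      it cannot hold two distinct neighbours.\<close>
    have eq: "k = j" if "occurs_between k u ?p (?p + 2)" for k
    proof -
      obtain r where "?p < r" "r < ?p + 2" "u ! r = k"
        using \<open>occurs_between k u ?p (?p + 2)\<close> unfolding occurs_between_def by blast
      then show "k = j"
        using u_eq by (auto simp: nth_append less_Suc_eq)
    qed
    have "?p < ?p + 2 \<and> ?p + 2 < length u \<and> u ! ?p = i \<and> u ! (?p + 2) = i"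
      using u_eq by (simp add: nth_append)
    then show False
      using between u i eq neq by metis
  qed
  then show "\<not> sublist [i, letter W n (i + 1), i] u \<and> \<not> sublist [i, letter W n (i - 1), i] u"
    by blast
qed

end
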